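(* Let $n\ge 4$. Let $0<z_1<\cdots<z_{n-1}$ be the nonzero roots of $N_n(-x)$ and $0<x_1<\cdots<x_{n-3}$ the nonzero roots of $N_{n-2}(-x)$, where $N_m$ denotes the $m$th Narayana polynomial. Then the two sets of roots satisfy the second interlacing property: for $i=1,\dots,\lfloor (n-3)/2\rfloor$ one has $x_i\in(z_i,z_{i+1})$ and $x_{n-2-i}\in(z_{n-1-i},z_{n-i})$; and if $n$ is even, then $x_{(n-2)/2}=z_{n/2}=1$.
   Context: The Narayana polynomial is $N_m(x)=\sum_{i=1}^m N_{m,i}x^i$, where $N_{m,i}=\frac1m\binom{m}{i}\binom{m}{i-1}$ are the Narayana numbers. It is known that $N_m$ has a simple root at $0$ and $m-1$ further distinct real negative roots, so that $N_m(-x)$ has exactly $m-1$ nonzero roots, all positive and distinct. *)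

theory Defs
  imports Complex_Main "HOL-Computational_Algebra.Polynomial"
begin

definition narayana :: "nat \<Rightarrow> nat \<Rightarrow> real" where
  "narayana m i = 1 / real m * real (m choose i) * real (m choose (i - 1))"

definition narayana_poly :: "nat \<Rightarrow> real poly" where
  "narayana_poly m = (\<Sum>i=1..m. monom (narayana m i) i)"

end

theory Submission
  imports Defs
begin

text \<open>
  Write \<open>N\<^sub>m\<close> for the Narayana polynomials. They satisfy
  \<open>(m + 3) N\<^sub>m\<^sub>+\<^sub>2 = (2 m + 3) (1 + x) N\<^sub>m\<^sub>+\<^sub>1 - m (1 - x)\<^sup>2 N\<^sub>m\<close>.
  A Christoffel--Darboux argument on this recurrence shows that a weighted Wronskian of
  \<open>N\<^sub>n\<close> and \<open>N\<^sub>n\<^sub>-\<^sub>1\<close> is positive on the negative axis, so \<open>N\<^sub>n'\<close> and \<open>N\<^sub>n\<^sub>-\<^sub>1\<close>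
  have equal signs at the negative roots of \<open>N\<^sub>n\<close>. At the roots in \<open>(-1, 0)\<close> the recurrence
  gives \<open>N\<^sub>n\<^sub>-\<^sub>1\<close> and \<open>N\<^sub>n\<^sub>-\<^sub>2\<close> equal signs as well. Hence \<open>N\<^sub>n\<^sub>-\<^sub>2\<close> alternates along these roots and
  vanishes between any two neighbours. By the symmetry \<open>t \<mapsto> 1/t\<close> of the roots,
  exactly \<open>(n - 3) div 2\<close> of the \<open>x\<^sub>i\<close> are below \<open>1\<close>, so the roots found in this way are all of these;
  the symmetry then also yields the intervals beyond \<open>1\<close> and the middle roots.
\<close>

section \<open>Coefficients and the three-term recurrence\<close>

text \<open>The truncated \<open>i - 1\<close> gives \<open>narayana m 0\<close> the value
  \<open>1 / m\<close>, so index 0 is split off; above \<open>m\<close> the binomials vanish by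
  themselves.\<close>

lemma coeff_narayana_poly:
  "coeff (narayana_poly m) i = (if i = 0 then 0 else narayana m i)"
proof -
  have "coeff (narayana_poly m) i = (\<Sum>k=1..m. if k = i then narayana m k else 0)"
    by (simp add: narayana_poly_def coeff_sum)
  also have "\<dots> = (if i \<in> {1..m} then narayana m i else 0)"
    by (simp add: sum.delta)
  finally show ?thesis
    by (auto simp: narayana_def not_le)
qed

lemma binomial_Suc_right_real:
  "real (m choose Suc k) = (real m - real k) / real (Suc k) * real (m choose k)"
proof (cases "k \<le> m")
  case True
  have "Suc k * (m choose Suc k) = (m - k) * (m choose k)"
    by (simp only: binomial_absorb_comp binomial_absorption)
  then have "real (Suc k) * real (m choose Suc k) = (real m - real k) * real (m choose k)"
    using True by (metis of_nat_diff of_nat_mult)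
  then show ?thesis
    by (simp add: field_simps)
qed (simp add: not_le binomial_eq_0)

text \<open>With the offset \<open>j + 3\<close> no lower index is truncated, and every binomial
  reduces to a rational multiple of \<open>m choose j\<close>.\<close>

lemma narayana_recurrence:
  assumes "m > 0"
  shows "real (m + 3) * narayana (m + 2) (j + 3) =
    real (2 * m + 3) * (narayana (m + 1) (j + 3) + narayana (m + 1) (j + 2))
      - real m * (narayana m (j + 3) - 2 * narayana m (j + 2) + narayana m (j + 1))"
proof -
  define b M J where "b = real (m choose j)" and "M = real m" and "J = real j"
  have M: "M > 0" and J: "J \<ge> 0"
    using assms by (auto simp: M_def J_def)
  have B: "real (m choose (j + 1)) = (M - J) / (J + 1) * b"
    "real (m choose (j + 2)) = (M - J - 1) / (J + 2) * real (m choose (j + 1))"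
    "real (m choose (j + 3)) = (M - J - 2) / (J + 3) * real (m choose (j + 2))"
    using binomial_Suc_right_real[of m j] binomial_Suc_right_real[of m "j + 1"]
      binomial_Suc_right_real[of m "j + 2"]
    by (simp_all add: b_def M_def J_def eval_nat_numeral add_ac diff_diff_eq)
  have e: "real (2 * m + 3) = 2 * M + 3" "real (m + 3) = M + 3" "real (m + 2) = M + 2" "real (m+1) = M + 1"
    "real m = M" by (simp_all add: M_def)
  have b0: "real (m choose j) = b" by (simp add: b_def)
  have c1: "real ((m + 1) choose (j + 1)) = real (m choose (j + 1)) + real (m choose j)"
    "real ((m + 1) choose (j + 2)) = real (m choose (j + 2)) + real (m choose (j + 1))"
    "real ((m + 1) choose (j + 3)) = real (m choose (j + 3)) + real (m choose (j + 2))"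
    by (simp_all add: eval_nat_numeral)
  have c2: "real ((m + 2) choose (j + 2)) = real ((m + 1) choose (j + 2)) + real ((m + 1) choose (j + 1))"
    "real ((m + 2) choose (j + 3)) = real ((m + 1) choose (j + 3)) + real ((m + 1) choose (j + 2))"
    by (simp_all add: eval_nat_numeral)
  have i: "j + 3 - 1 = j + 2" "j + 2 - 1 = j + 1" "j + 1 - 1 = j" by simp_all
  have nz: "M \<noteq> 0" "M + 1 \<noteq> 0" "M + 2 \<noteq> 0" "J + 1 \<noteq> 0" "J + 2 \<noteq> 0" "J + 3 \<noteq> 0"
    using M J by auto
  show ?thesis
    unfolding narayana_def i e c2 c1 B b0 
    using nz by (simp add: divide_simps) algebra
qed


lemma narayana_poly_recurrence:
  assumes "m > 0"
  shows "smult (real (m + 3)) (narayana_poly (m + 2)) =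
    smult (real (2 * m + 3)) ([:1, 1:] * narayana_poly (m + 1))
      - smult (real m) ([:1, -2, 1:] * narayana_poly m)" (is "?l = ?r")
proof (rule poly_eqI)
  fix i :: nat
  \<comment> \<open>The coefficient recurrence starts at 3: at \<open>i = 2\<close> it would use
    \<open>narayana m 0 = 1 / m\<close> where the polynomial has coefficient 0.\<close>
  consider "i = 0" | "i = 1" | "i = 2" | j where "i = j + 3"
    by (metis One_nat_def Suc_1 add.commute add_Suc_right add_0_right not0_implies_Suc numeral_3_eq_3)
  then show "coeff ?l i = coeff ?r i"
  proof cases
    case 1
    then show ?thesis
      by (simp add: coeff_narayana_poly)
  next
    case 2
    then show ?thesis
      using assms by (simp add: coeff_narayana_poly narayana_def)
  next
    case 3
    have c: "real (k choose 2) = real k * (real k - 1) / 2" for k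
      by (cases k) (simp_all add: choose_two real_of_nat_div algebra_simps)
    have n: "narayana k 2 = real k * (real k - 1) / 2" "narayana k 1 = 1" if "k > 0" for k
      using that by (simp_all add: narayana_def c)
    have "coeff ?r i = real (2 * m + 3) * (narayana (m + 1) 2 + narayana (m + 1) 1)
        - real m * (narayana m 2 - 2 * narayana m 1)"
      by (simp add: 3 coeff_narayana_poly coeff_pCons eval_nat_numeral algebra_simps)
    also have "\<dots> = real (m + 3) * (real (m + 2) * (real (m + 2) - 1) / 2)"
      unfolding n[OF assms] n[OF add_pos_pos[OF assms zero_less_one]]
      by (simp add: field_simps)
    also have "\<dots> = coeff ?l i"
      by (simp add: 3 coeff_narayana_poly n)
    finally show ?thesis
      by (rule sym)
  next
    case 4
    then show ?thesis
      using narayana_recurrence[OF assms, of j]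
      by (simp add: coeff_narayana_poly coeff_pCons eval_nat_numeral algebra_simps)
  qed
qed

lemma poly_narayana_recurrence:
  assumes "m > 0"
  shows "real (m + 3) * poly (narayana_poly (m + 2)) x =
    real (2 * m + 3) * (1 + x) * poly (narayana_poly (m + 1)) x
      - real m * (1 - x)\<^sup>2 * poly (narayana_poly m) x"
  using arg_cong[OF narayana_poly_recurrence[OF assms], of "\<lambda>p. poly p x"]
  by (simp add: algebra_simps power2_eq_square)

lemma poly_pderiv_narayana_recurrence:
  assumes "m > 0"
  shows "real (m + 3) * poly (pderiv (narayana_poly (m + 2))) x =
    real (2 * m + 3) * (poly (narayana_poly (m + 1)) x
      + (1 + x) * poly (pderiv (narayana_poly (m + 1))) x)
      - real m * ((1 - x)\<^sup>2 * poly (pderiv (narayana_poly m)) x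
      - 2 * (1 - x) * poly (narayana_poly m) x)"
  using arg_cong[OF narayana_poly_recurrence[OF assms], of "\<lambda>p. poly (pderiv p) x"]
  by (simp add: pderiv_smult pderiv_mult pderiv_diff pderiv_pCons power2_eq_square
      del: mult_pCons_left mult_pCons_right) (simp add: algebra_simps)

section \<open>Positivity of the weighted Wronskian\<close>

text \<open>
  The quotients \<open>N\<^sub>m / (1 - x)\<^sup>m\<^sup>-\<^sup>1\<close> are (Gegenbauer) orthogonal polynomials in
  \<open>(1 + x) / (1 - x)\<close>, up to a common factor. Their Wronskian, cleared of denominators, is the
  expression below; the plain Wronskian would leave mixed terms in its recursion.
\<close>

definition narayana_wronskian :: "nat \<Rightarrow> real \<Rightarrow> real" where
  "narayana_wronskian m x =
    (1 - x) * (poly (pderiv (narayana_poly (m + 1))) x * poly (narayana_poly m) x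
      - poly (narayana_poly (m + 1)) x * poly (pderiv (narayana_poly m)) x)
    + poly (narayana_poly (m + 1)) x * poly (narayana_poly m) x"

text \<open>After eliminating index \<open>m + 2\<close>, the products \<open>p1 * d1\<close> cancel
  and the weights \<open>1 - x\<close> and \<open>1 + x\<close> of the square add up to 2. The
  derivative of \<open>(1 - x)\<^sup>2\<close> supplies \<open>2 * p0 * p1\<close>, of which one
  copy remains to rebuild the Wronskian at \<open>m\<close>.\<close>

lemma narayana_wronskian_rec:
  assumes "m > 0"
  shows "real (m + 3) * narayana_wronskian (m + 1) x =
    2 * real (2 * m + 3) * (poly (narayana_poly (m + 1)) x)\<^sup>2
      + real m * (1 - x)\<^sup>2 * narayana_wronskian m x"
proof -
  define p0 p1 p2 d0 d1 d2 A B C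
    where "p0 = poly (narayana_poly m) x" "p1 = poly (narayana_poly (m + 1)) x"
      "p2 = poly (narayana_poly (m + 2)) x"
      "d0 = poly (pderiv (narayana_poly m)) x" "d1 = poly (pderiv (narayana_poly (m + 1))) x"
      "d2 = poly (pderiv (narayana_poly (m + 2))) x"
      "A = real (m + 3)" "B = real (2 * m + 3)" "C = real m"
  note defs = this
  have p: "A * p2 = B * (1 + x) * p1 - C * (1 - x)\<^sup>2 * p0"
    using poly_narayana_recurrence[OF assms, of x] by (simp only: defs)
  have d: "A * d2 = B * (p1 + (1 + x) * d1) - C * ((1 - x)\<^sup>2 * d0 - 2 * (1 - x) * p0)"
    using poly_pderiv_narayana_recurrence[OF assms, of x] by (simp only: defs)
  have "A * ((1 - x) * (d2 * p1 - p2 * d1) + p2 * p1) =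
      2 * B * p1\<^sup>2 + C * (1 - x)\<^sup>2 * ((1 - x) * (d1 * p0 - p1 * d0) + p1 * p0)"
    using p d by algebra
  then show ?thesis
    unfolding narayana_wronskian_def defs by (simp only: add.assoc one_add_one)
qed

lemma narayana_wronskian_pos:
  assumes "m > 0" "x < 0"
  shows "narayana_wronskian m x > 0"
  using assms(1)
proof (induction m rule: nat_induct_non_zero)
  case 1
  have "narayana_poly 1 = [:0, 1:]" "narayana_poly (1 + 1) = [:0, 1, 1:]"
    by (simp_all add: narayana_poly_def narayana_def monom_altdef numeral_2_eq_2)
  then have "narayana_wronskian 1 x = 2 * x\<^sup>2"
    unfolding narayana_wronskian_def
    by (simp add: pderiv_pCons algebra_simps power2_eq_square)
  then show ?case
    using assms by simp
next
  case (Suc m)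
  have "0 < real m * (1 - x)\<^sup>2 * narayana_wronskian m x"
    using Suc assms by simp
  moreover have "0 \<le> 2 * real (2 * m + 3) * (poly (narayana_poly (m + 1)) x)\<^sup>2"
    by simp
  ultimately have "0 < real (m + 3) * narayana_wronskian (m + 1) x"
    by (simp only: narayana_wronskian_rec[OF Suc.hyps(1)])
  then show ?case
    by (simp add: zero_less_mult_iff)
qed

text \<open>At the root the Wronskian reduces to \<open>(1 - x) * d2 * p1\<close>, and the
  recurrence makes \<open>(1 + x) * p1\<close> a positive multiple of \<open>p0\<close>;
  \<open>- 1 < x\<close> keeps the sign.\<close>

lemma narayana_pderiv_mult_pos:
  assumes "m > 0" "- 1 < x" "x < 0" "poly (narayana_poly (m + 2)) x = 0"
  shows "poly (pderiv (narayana_poly (m + 2))) x * poly (narayana_poly m) x > 0"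
proof -
  define p0 p1 d2
    where "p0 = poly (narayana_poly m) x" "p1 = poly (narayana_poly (m + 1)) x"
      "d2 = poly (pderiv (narayana_poly (m + 2))) x"
  note defs = this
  have "narayana_wronskian (m + 1) x = (1 - x) * (d2 * p1)"
    using assms(4) by (simp add: narayana_wronskian_def defs)
  then have "d2 * p1 > 0"
    using narayana_wronskian_pos[of "m + 1" x] assms by (simp add: zero_less_mult_iff)
  moreover have r: "(real (2 * m + 3) * (1 + x)) * p1 = (real m * (1 - x)\<^sup>2) * p0"
    using poly_narayana_recurrence[OF assms(1), of x] assms(4) by (simp add: defs)
  have "real (2 * m + 3) * (1 + x) > 0"
    using assms by (intro mult_pos_pos) auto
  ultimately have "0 < d2 * ((real (2 * m + 3) * (1 + x)) * p1)"
    by (simp only: mult.left_commute[of d2] mult_pos_pos)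
  then have "0 < (real m * (1 - x)\<^sup>2) * (d2 * p0)"
    by (simp only: r mult.left_commute[of d2])
  moreover have "real m * (1 - x)\<^sup>2 > 0"
    using assms by simp
  ultimately show ?thesis
    by (simp only: zero_less_mult_pos defs)
qed

section \<open>Alternating signs and roots between neighbours\<close>

text \<open>Otherwise \<open>p\<close> would be positive just right of \<open>a\<close> and negative
  just left of \<open>b\<close>, hence vanish in between.\<close>

lemma pderiv_sign_change:
  fixes p :: "real poly"
  assumes "a < b" "poly p a = 0" "poly p b = 0"
    and nz: "\<And>y. a < y \<Longrightarrow> y < b \<Longrightarrow> poly p y \<noteq> 0"
  shows "\<not> (poly (pderiv p) a > 0 \<and> poly (pderiv p) b > 0)"
proof
  assume *: "poly (pderiv p) a > 0 \<and> poly (pderiv p) b > 0"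
  obtain d where d: "d > 0" "\<And>h. 0 < h \<Longrightarrow> h < d \<Longrightarrow> poly p (a + h) > 0"
    using DERIV_pos_inc_right[OF poly_DERIV[of p a]] * assms by auto
  obtain e where e: "e > 0" "\<And>h. 0 < h \<Longrightarrow> h < e \<Longrightarrow> poly p (b - h) < 0"
    using DERIV_pos_inc_left[OF poly_DERIV[of p b]] * assms by auto
  \<comment> \<open>Dividing by 3 keeps \<open>a + h\<close> to the left of
    \<open>b - h\<close>.\<close>
  define h where "h = min (min d e) (b - a) / 3"
  have h: "0 < h" "h < d" "h < e" "a + h < b - h"
    using assms(1) d(1) e(1) by (auto simp: h_def min_def field_simps)
  obtain y where "a + h < y" "y < b - h" "poly p y = 0"
    using poly_IVT_neg[OF h(4)] d(2) e(2) h by blast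
  then show False
    using nz[of y] h by auto
qed

lemma narayana_root_between:
  assumes "m > 0" "- 1 < a" "a < b" "b < 0"
    and z: "poly (narayana_poly (m + 2)) a = 0" "poly (narayana_poly (m + 2)) b = 0"
    and nz: "\<And>y. a < y \<Longrightarrow> y < b \<Longrightarrow> poly (narayana_poly (m + 2)) y \<noteq> 0"
  shows "\<exists>y. a < y \<and> y < b \<and> poly (narayana_poly m) y = 0"
proof -
  have pa: "poly (pderiv (narayana_poly (m + 2))) a * poly (narayana_poly m) a > 0"
    and pb: "poly (pderiv (narayana_poly (m + 2))) b * poly (narayana_poly m) b > 0"
    using assms by (intro narayana_pderiv_mult_pos; simp)+
  have s1: "\<not> (poly (pderiv (narayana_poly (m + 2))) a > 0 \<and> poly (pderiv (narayana_poly (m + 2))) b > 0)"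
    by (rule pderiv_sign_change) (use assms in auto)
  \<comment> \<open>The negated polynomial excludes two negative derivatives; neither is zero by
    \<open>pa\<close> and \<open>pb\<close>, so their signs are opposite.\<close>
  have s2: "\<not> (poly (pderiv (- narayana_poly (m + 2))) a > 0 \<and> poly (pderiv (- narayana_poly (m + 2))) b > 0)"
    by (rule pderiv_sign_change) (use assms in auto)
  have "poly (narayana_poly m) a * poly (narayana_poly m) b < 0"
    using pa pb s1 s2 by (auto simp: zero_less_mult_iff mult_less_0_iff pderiv_minus)
  then show ?thesis
    using poly_IVT[OF assms(3)] by blast
qed

section \<open>Reciprocal symmetry of the roots\<close>

text \<open>The coefficients are palindromic: replacing \<open>i\<close> by \<open>m + 1 - i\<close>
  swaps the two binomial factors.\<close>

lemma poly_narayana_inverse: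
  assumes "x \<noteq> 0"
  shows "poly (narayana_poly m) x = x ^ (m + 1) * poly (narayana_poly m) (inverse x)"
proof -
  have sym: "narayana m (m + 1 - i) = narayana m i" if "i \<in> {1..m}" for i
  proof -
    have e: "m + 1 - i = m - (i - 1)" "m - (i - 1) - 1 = m - i" "i - 1 \<le> m" "i \<le> m"
      using that by auto
    have "m choose (m + 1 - i) = m choose (i - 1)" "m choose (m + 1 - i - 1) = m choose i"
      unfolding e(1,2) by (rule binomial_symmetric[symmetric], rule e)+
    then show ?thesis
      unfolding narayana_def by (simp only: mult_ac)
  qed
  have "poly (narayana_poly m) x = (\<Sum>i=1..m. narayana m i * x ^ i)"
    by (simp add: narayana_poly_def poly_sum poly_monom)
  also have "\<dots> = (\<Sum>i=1..m. narayana m (m + 1 - i) * x ^ (m + 1 - i))"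
    by (subst sum.atLeastAtMost_rev) (simp add: add.commute)
  also have "\<dots> = (\<Sum>i=1..m. x ^ (m + 1) * (narayana m i * inverse x ^ i))"
  proof (rule sum.cong[OF refl])
    fix i assume i: "i \<in> {1..m}"
    have "x ^ (m + 1 - i) = x ^ (m + 1) * inverse x ^ i"
      using i assms by (simp add: power_diff power_inverse field_simps del: power_Suc)
    then show "narayana m (m + 1 - i) * x ^ (m + 1 - i) = x ^ (m + 1) * (narayana m i * inverse x ^ i)"
      by (simp only: sym[OF i] mult_ac)
  qed
  also have "\<dots> = x ^ (m + 1) * poly (narayana_poly m) (inverse x)"
    by (simp add: narayana_poly_def poly_sum poly_monom sum_distrib_left)
  finally show ?thesis .
qed

section \<open>Increasing enumerations of sets closed under reciprocals\<close>

lemma strict_mono_on_enumeration_unique: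
  fixes f g :: "nat \<Rightarrow> 'a::linorder"
  assumes "strict_mono_on {1..k} f" "strict_mono_on {1..k} g" "f ` {1..k} = g ` {1..k}" "i \<in> {1..k}"
  shows "f i = g i"
proof -
  have s: "sorted_wrt (<) (map h [1..<Suc k])" if "strict_mono_on {1..k} h" for h :: "nat \<Rightarrow> 'a"
    using that by (auto simp: sorted_wrt_iff_nth_less strict_mono_on_def simp del: upt_Suc)
  have "map f [1..<Suc k] = map g [1..<Suc k]"
    by (rule strict_sorted_equal[OF s[OF assms(2)] s[OF assms(1)]])
      (use assms(3) in \<open>simp add: atLeastLessThanSuc_atLeastAtMost del: upt_Suc\<close>)
  then show ?thesis
    using assms(4) by (simp del: upt_Suc)
qed

text \<open>Reversing the order and taking reciprocals gives another increasing enumeration of the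
  same set, hence the same one.\<close>

lemma enumeration_inverse:
  fixes f :: "nat \<Rightarrow> real"
  assumes mono: "strict_mono_on {1..k} f" and pos: "f 1 > 0"
    and inv: "\<And>t. t \<in> f ` {1..k} \<Longrightarrow> inverse t \<in> f ` {1..k}"
    and i: "i \<in> {1..k}"
  shows "f (k + 1 - i) = inverse (f i)"
proof -
  have p: "f j > 0" if "j \<in> {1..k}" for j
    using that pos strict_mono_onD[OF mono, of 1 j] by (cases "j = 1") auto
  define g where "g j = inverse (f (k + 1 - j))" for j
  have g: "strict_mono_on {1..k} g"
    by (auto simp: strict_mono_on_def g_def intro!: less_imp_inverse_less strict_mono_onD[OF mono] p)
  have rev: "(\<lambda>j. k + 1 - j) ` {1..k} = {1..k}"
    by (rule bij_betw_imp_surj_on[OF bij_betw_byWitness[where f' = "\<lambda>j. k + 1 - j"]]) auto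
  have "g ` {1..k} = inverse ` f ` (\<lambda>j. k + 1 - j) ` {1..k}"
    by (simp add: image_image g_def)
  also have "\<dots> = f ` {1..k}"
    unfolding rev
  proof (intro equalityI subsetI)
    fix t assume "t \<in> f ` {1..k}"
    then show "t \<in> inverse ` f ` {1..k}"
      using inv[of t] by (metis image_eqI inverse_inverse_eq)
  qed (use inv in blast)
  finally have "g i = f i"
    by (intro strict_mono_on_enumeration_unique[OF g mono _ i])
  then show ?thesis
    by (metis g_def inverse_inverse_eq)
qed

text \<open>Comparing \<open>f i\<close> with its mirror value \<open>inverse (f i)\<close> amounts
  to comparing \<open>i\<close> with \<open>k + 1 - i\<close>, and for positive numbers also to
  comparing \<open>f i\<close> with 1.\<close>

lemma enumeration_inverse_less_one_iff:
  fixes f :: "nat \<Rightarrow> real"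
  assumes mono: "strict_mono_on {1..k} f" and pos: "f 1 > 0"
    and inv: "\<And>t. t \<in> f ` {1..k} \<Longrightarrow> inverse t \<in> f ` {1..k}"
    and i: "i \<in> {1..k}"
  shows "f i < 1 \<longleftrightarrow> 2 * i < k + 1" and "f i = 1 \<longleftrightarrow> 2 * i = k + 1"
proof -
  have p: "f i > 0"
    using i pos strict_mono_onD[OF mono, of 1 i] by (cases "i = 1") auto
  have r: "f (k + 1 - i) = inverse (f i)"
    by (rule enumeration_inverse[OF mono pos inv i])
  have i': "i \<in> {1..k}" "k + 1 - i \<in> {1..k}"
    using i by auto
  have *: "f i < inverse (f i) \<longleftrightarrow> i < k + 1 - i" "f i = inverse (f i) \<longleftrightarrow> i = k + 1 - i"
    unfolding r[symmetric] using i' by (simp_all only: strict_mono_on_less[OF mono]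
      strict_mono_on_eq[OF mono])
  have "f i < inverse (f i) \<longleftrightarrow> f i < 1"
    using p by (smt (verit) one_less_inverse_iff inverse_le_1_iff)
  moreover have "f i = inverse (f i) \<longleftrightarrow> f i = 1"
    using p by (smt (verit) one_less_inverse_iff inverse_less_1_iff inverse_1)
  ultimately show "f i < 1 \<longleftrightarrow> 2 * i < k + 1" and "f i = 1 \<longleftrightarrow> 2 * i = k + 1"
    using * i by auto
qed

section \<open>Interlacing of the two root sequences\<close>

theorem theorem22:
  fixes n :: nat and z x :: "nat \<Rightarrow> real"
  assumes "n \<ge> 4"
    and "0 < z 1" and "strict_mono_on {1..n-1} z"
    and "z ` {1..n-1} = {t. t \<noteq> 0 \<and> poly (narayana_poly n) (- t) = 0}"
    and "0 < x 1" and "strict_mono_on {1..n-3} x"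
    and "x ` {1..n-3} = {t. t \<noteq> 0 \<and> poly (narayana_poly (n - 2)) (- t) = 0}"
  shows "(\<forall>i\<in>{1..(n - 3) div 2}.
            x i \<in> {z i <..< z (i + 1)} \<and>
            x (n - 2 - i) \<in> {z (n - 1 - i) <..< z (n - i)}) \<and>
         (even n \<longrightarrow> x ((n - 2) div 2) = 1 \<and> z (n div 2) = 1)"
proof -
  have roots_inv: "inverse t \<in> {t. t \<noteq> 0 \<and> poly (narayana_poly m) (- t) = 0}"
    if "t \<in> {t. t \<noteq> 0 \<and> poly (narayana_poly m) (- t) = 0}" for m t
    using that poly_narayana_inverse[of "- t" m] by auto
  note z = assms(3,2) roots_inv[of _ n, folded assms(4)]
  note x = assms(6,5) roots_inv[of _ "n - 2", folded assms(7)]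
  have z_pos: "z j > 0" if "j \<in> {1..n-1}" for j
    using that assms(2) strict_mono_onD[OF assms(3), of 1 j] by (cases "j = 1") auto
  have z_inv: "z (n - j) = inverse (z j)" if "j \<in> {1..n-1}" for j
    using enumeration_inverse[OF z that] assms(1) by simp
  have x_inv: "x (n - 2 - j) = inverse (x j)" if "j \<in> {1..n-3}" for j
    using enumeration_inverse[OF x that] assms(1) by (simp add: Suc_diff_le numeral_eq_Suc)
  have z_less_1: "z j < 1 \<longleftrightarrow> 2 * j < n" if "j \<in> {1..n-1}" for j
    using enumeration_inverse_less_one_iff(1)[OF z that] assms(1) by simp
  have x_less_1: "x j < 1 \<longleftrightarrow> 2 * j < n - 2" if "j \<in> {1..n-3}" for j
    using enumeration_inverse_less_one_iff(1)[OF x that] assms(1) that by auto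
  \<comment> \<open>Exactly the first \<open>K\<close> of the \<open>x j\<close> lie below 1, and
    \<open>i \<le> K\<close> still gives \<open>z (i + 1) < 1\<close>.\<close>
  define K where "K = (n - 3) div 2"
  have "\<exists>w. z i < w \<and> w < z (i + 1) \<and> poly (narayana_poly (n - 2)) (- w) = 0"
    if i: "i \<in> {1..K}" for i
  proof -
    have i': "i \<in> {1..n-1}" "i + 1 \<in> {1..n-1}" "2 * (i + 1) < n"
      using i assms(1) by (auto simp: K_def)
    have n2: "n - 2 + 2 = n"
      using assms(1) by simp
    have root: "poly (narayana_poly n) (- z j) = 0" if "j \<in> {1..n-1}" for j
      using imageI[OF that, of z] unfolding assms(4) by simp
    have "\<exists>y. - z (i + 1) < y \<and> y < - z i \<and> poly (narayana_poly (n - 2)) y = 0"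
    proof (rule narayana_root_between, unfold n2)
      show "poly (narayana_poly n) y \<noteq> 0" if y: "- z (i + 1) < y" "y < - z i" for y
      proof
        assume "poly (narayana_poly n) y = 0"
        then have "- y \<in> z ` {1..n-1}"
          unfolding assms(4) using y z_pos[OF i'(1)] by auto
        then obtain j where j: "j \<in> {1..n-1}" "- y = z j"
          by blast
        then have "z i < z j" "z j < z (i + 1)"
          using y by auto
        then have "i < j" "j < i + 1"
          using j i' by (auto simp: strict_mono_on_less[OF assms(3)])
        then show False
          by simp
      qed
    qed (use assms(1) i' root z_less_1[OF i'(2)] z_pos[OF i'(1)]
        strict_mono_onD[OF assms(3), of i "i + 1"] in auto)
    then show ?thesis
      by (metis minus_less_iff less_minus_iff minus_minus)
  qed
  then obtain w where w: "\<And>i. i \<in> {1..K} \<Longrightarrow>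
      z i < w i \<and> w i < z (i + 1) \<and> poly (narayana_poly (n - 2)) (- w i) = 0"
    by metis
  have z_le: "z i \<le> z j" if "i \<le> j" "i \<in> {1..n-1}" "j \<in> {1..n-1}" for i j
    using that strict_mono_on_leD[OF assms(3)] by blast
  have mono_w: "strict_mono_on {1..K} w"
  proof (rule strict_mono_onI)
    fix i j assume ij: "i \<in> {1..K}" "j \<in> {1..K}" "i < j"
    then have "z (i + 1) \<le> z j"
      by (intro z_le) (auto simp: K_def)
    then show "w i < w j"
      using w[OF ij(1)] w[OF ij(2)] by linarith
  qed
  have mono_x: "strict_mono_on {1..K} x"
    using assms(6) by (rule monotone_on_subset) (auto simp: K_def)
  \<comment> \<open>A priori \<open>w i\<close> is just some \<open>x j\<close>; lying below
    \<open>z (i + 1) < 1\<close> forces \<open>j \<le> K\<close>. Equal cardinality then turns the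
    inclusion into equality.\<close>
  have "w ` {1..K} \<subseteq> x ` {1..K}"
  proof (rule image_subsetI)
    fix i assume i: "i \<in> {1..K}"
    then have i': "i \<in> {1..n-1}" "i + 1 \<in> {1..n-1}" "2 * (i + 1) < n"
      using assms(1) by (auto simp: K_def)
    have "w i \<in> x ` {1..n-3}"
      unfolding assms(7) using w[OF i] z_pos[OF i'(1)] by auto
    then obtain j where j: "j \<in> {1..n-3}" "w i = x j"
      by blast
    then have "2 * j < n - 2"
      using w[OF i] i' x_less_1[OF j(1)] z_less_1[OF i'(2)] by auto
    then show "w i \<in> x ` {1..K}"
      using j by (auto simp: K_def)
  qed
  then have image_eq: "w ` {1..K} = x ` {1..K}"
    by (rule card_subset_eq[OF finite_imageI[OF finite_atLeastAtMost]])
      (simp only: card_image strict_mono_on_imp_inj_on mono_w mono_x)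
  have x_between: "z i < x i \<and> x i < z (i + 1)" if "i \<in> {1..K}" for i
    using w[OF that] strict_mono_on_enumeration_unique[OF mono_w mono_x image_eq that] by simp
  have "x i \<in> {z i <..< z (i + 1)} \<and> x (n - 2 - i) \<in> {z (n - 1 - i) <..< z (n - i)}"
    if i: "i \<in> {1..K}" for i
  proof -
    have i': "i \<in> {1..n-1}" "i + 1 \<in> {1..n-1}" "i \<in> {1..n-3}"
      using i assms(1) by (auto simp: K_def)
    \<comment> \<open>Reciprocals reverse \<open>z i < x i < z (i + 1)\<close>; the mirror index of
      \<open>i + 1\<close> is \<open>n - 1 - i\<close>.\<close>
    have z_inv': "z (n - 1 - i) = inverse (z (i + 1))"
      using z_inv[OF i'(2)] by simp
    show ?thesis
      unfolding z_inv' z_inv[OF i'(1)] x_inv[OF i'(3)]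
      using x_between[OF i] z_pos[OF i'(1)] by (auto intro: less_imp_inverse_less)
  qed
  \<comment> \<open>Both enumerations have odd length here, so each has a middle index that is its
    own mirror.\<close>
  moreover have "x ((n - 2) div 2) = 1 \<and> z (n div 2) = 1" if "even n"
  proof -
    have "(n - 2) div 2 \<in> {1..n-3}" "2 * ((n - 2) div 2) = n - 3 + 1"
      "n div 2 \<in> {1..n-1}" "2 * (n div 2) = n - 1 + 1"
      using that assms(1) by auto
    then show ?thesis
      using enumeration_inverse_less_one_iff(2)[OF x] enumeration_inverse_less_one_iff(2)[OF z]
      by blast
  qed
  ultimately show ?thesis
    unfolding K_def by blast
qed

end
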